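(* If the statement $\Phi_5$ holds, then there are infinitely many positive integers $m$ such that $m!-1$ is prime.
   Context: Define $f:\{1,2,3,\ldots\}\to\mathbb{N}$ by $f(1)=2$, $f(2)=3$, and $f(n+1)=f(n)!$ for every integer $n\geqslant 2$. Write $x\not\mid y$ to mean that $x$ does not divide $y$. For a positive integer $n$, $\Phi_n$ denotes the statement: for every system $\mathcal{S}$ that is a subset of $\{x_i+1=x_k,\ x_i!=x_k,\ x_i\not\mid x_k : i,k\in\{1,\ldots,n\}\}$, if $\mathcal{S}$ has only finitely many solutions in positive integers $x_1,\ldots,x_n$, then every such solution $(x_1,\ldots,x_n)$ satisfies $x_1,\ldots,x_n\leqslant f(n)$. *)

theory Defs
  imports Complex_Main "HOL-Computational_Algebra.Primes" "HOL-Library.FuncSet"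
begin

(* The argument ranges over the positive integers; the value at 0 is left unspecified. *)
fun bound_f :: "nat \<Rightarrow> nat" where
  "bound_f (Suc 0) = 2"
| "bound_f (Suc (Suc 0)) = 3"
| "bound_f (Suc (Suc (Suc n))) = fact (bound_f (Suc (Suc n)))"

(* Succ_Eq i k:  x_i + 1 = x_k;   Fact_Eq i k:  x_i! = x_k;   Not_Dvd i k:  x_i does not divide x_k *)
datatype condition = Succ_Eq nat nat | Fact_Eq nat nat | Not_Dvd nat nat

definition conditions :: "nat \<Rightarrow> condition set" where
  "conditions n =
     {c. \<exists>i\<in>{1..n}. \<exists>k\<in>{1..n}. c = Succ_Eq i k \<or> c = Fact_Eq i k \<or> c = Not_Dvd i k}"

fun satisfies :: "(nat \<Rightarrow> nat) \<Rightarrow> condition \<Rightarrow> bool" where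
  "satisfies x (Succ_Eq i k) \<longleftrightarrow> x i + 1 = x k"
| "satisfies x (Fact_Eq i k) \<longleftrightarrow> fact (x i) = x k"
| "satisfies x (Not_Dvd i k) \<longleftrightarrow> \<not> x i dvd x k"

(* An n-tuple (x_1, ..., x_n) of positive integers is a function in the extensional function space
   over {1..n}, so that distinct solutions are distinct tuples and counting them is meaningful. *)
definition solutions :: "nat \<Rightarrow> condition set \<Rightarrow> (nat \<Rightarrow> nat) set" where
  "solutions n S = {x \<in> {1..n} \<rightarrow>\<^sub>E {1..}. \<forall>c\<in>S. satisfies x c}"

definition Phi :: "nat \<Rightarrow> bool" where
  "Phi n \<longleftrightarrow>
     (\<forall>S. S \<subseteq> conditions n \<longrightarrow> finite (solutions n S) \<longrightarrow>
        (\<forall>x\<in>solutions n S. \<forall>i\<in>{1..n}. x i \<le> bound_f n))"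

end

(*
  By Wilson's theorem and its converse, n > 4 is prime iff n does not divide (n - 1)!.  Hence the
  system  x1! = x2, x3 + 1 = x2, x4 + 1 = x3, x4! = x5, x3 does not divide x5  says that
  x3 = x1! - 1 is prime.  Since 7! - 1 = 5039 is prime, it has a solution with
  x5 = 5038! > 720! = f(5), so under Phi 5 it has infinitely many solutions, and each is
  determined by x1.
*)
theory Submission
  imports Defs
begin

text \<open>Since \<open>a < b\<close>, the factor \<open>a\<close> already occurs in
  \<open>(b - 1)!\<close>, and \<open>b! = b * (b - 1)!\<close> supplies \<open>b\<close>
  separately.\<close>

lemma mult_dvd_fact:
  fixes a b n :: nat
  assumes "0 < a" "a < b" "b \<le> n"
  shows "a * b dvd fact n"
proof -
  have "a dvd fact (b - 1)"
    using assms by (intro dvd_fact) auto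
  then have "a * b dvd fact b"
    using assms by (simp add: fact_reduce[of b] mult.commute mult_dvd_mono)
  also have "(fact b :: nat) dvd fact n"
    using assms by (intro fact_dvd) auto
  finally show ?thesis .
qed

lemma composite_natE:
  fixes n :: nat
  assumes "1 < n" "\<not> prime n"
  obtains a b where "n = a * b" "1 < a" "1 < b"
proof -
  from assms obtain a where a: "a dvd n" "a \<noteq> 1" "a \<noteq> n"
    by (auto simp: prime_nat_iff)
  then obtain b where n: "n = a * b" by blast
  have "1 < a \<and> 1 < b"
    using n a \<open>1 < n\<close> by (cases "a = 0"; cases "b = 0"; force)
  with n that show thesis by blast
qed

text \<open>In a nontrivial factorisation \<open>n = a * b\<close> one factor lies below
  \<open>k\<close>, as otherwise the product would reach the square of \<open>k\<close>.\<close>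

lemma prime_if_no_small_divisor:
  fixes n k :: nat
  assumes "1 < n" "n < k\<^sup>2" and no_dvd: "\<forall>d\<in>{2..<k}. \<not> d dvd n"
  shows "prime n"
proof (rule ccontr)
  assume "\<not> prime n"
  with \<open>1 < n\<close> obtain a b where n: "n = a * b" and ab: "1 < a" "1 < b"
    by (rule composite_natE)
  have "a < k \<or> b < k"
  proof (rule ccontr)
    assume "\<not> (a < k \<or> b < k)"
    then have "k * k \<le> a * b" by (intro mult_le_mono) auto
    with \<open>n < k\<^sup>2\<close> n show False by (simp add: power2_eq_square)
  qed
  then show False
    using no_dvd[rule_format, of a] no_dvd[rule_format, of b] ab n by auto
qed

(* The simp rule for primality of numerals would try all divisors up to 5039 div 2. *)
lemma prime_5039: "prime (5039 :: nat)"
\<comment> \<open>71 is the least choice: 70 * 70 = 4900 and 71 * 71 = 5041.\<close>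
proof (rule prime_if_no_small_divisor[where k = 71])
  have "\<forall>d\<in>set [2..<71]. \<not> d dvd (5039 :: nat)" by simp
  then show "\<forall>d\<in>{2..<71}. \<not> d dvd (5039 :: nat)"
    by (simp only: set_upt)
qed simp_all

text \<open>Two distinct proper factors of a composite \<open>n\<close> occur separately in
  \<open>(n - 1)!\<close>; only squares need another argument. The exception is real: 4 does not
  divide 3! = 6.\<close>

lemma prime_if_not_dvd_fact_pred:
  fixes n :: nat
  assumes "0 < n" "n \<noteq> 4" and not_dvd: "\<not> n dvd fact (n - 1)"
  shows "prime n"
proof (rule ccontr)
  assume "\<not> prime n"
  have "n \<noteq> 1" using not_dvd by auto
  with \<open>0 < n\<close> have "1 < n" by simp
  from this \<open>\<not> prime n\<close> obtain a b where n: "n = a * b" and ab: "1 < a" "1 < b"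
    by (rule composite_natE)
  have "a < n" "b < n" unfolding n using ab by simp_all
  then have le: "a \<le> n - 1" "b \<le> n - 1" by linarith+
  consider "a < b" | "b < a" | "a = b" by linarith
  then show False
  proof cases
    case 1
    then show ?thesis
      using mult_dvd_fact[of a b "n - 1"] n ab le not_dvd by auto
  next
    case 2
    then show ?thesis
      using mult_dvd_fact[of b a "n - 1"] n ab le not_dvd by (auto simp: mult.commute)
  next
    case 3
    \<comment> \<open>For \<open>n = a * a\<close> the multiple \<open>2 * a\<close> serves as the
      second, distinct factor; it is below \<open>n\<close> because \<open>2 < a\<close>.\<close>
    with n \<open>n \<noteq> 4\<close> ab have "2 < a" by (cases "a = 2") auto
    with n 3 have "2 * a < n" by simp
    then have "a * (2 * a) dvd fact (n - 1)"
      using ab by (intro mult_dvd_fact) auto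
    moreover have "n dvd a * (2 * a)"
      using n 3 by simp
    ultimately show ?thesis
      using not_dvd dvd_trans by blast
  qed
qed

lemma prime_not_dvd_fact_pred:
  fixes p :: nat
  assumes "prime p"
  shows "\<not> p dvd fact (p - 1)"
  using assms prime_dvd_fact_iff[of p "p - 1"] prime_gt_0_nat[of p] by auto

text \<open>Rules out \<open>x 3 = 4\<close>, the exceptional case of the primality criterion, since
  \<open>x 3 + 1\<close> is a factorial.\<close>

lemma fact_neq_5: "fact m \<noteq> (5 :: nat)"
proof
  assume eq: "fact m = (5 :: nat)"
  show False
  proof (cases "m < 3")
    case True
    then have "m = 0 \<or> m = 1 \<or> m = 2" by linarith
    with eq show ?thesis by auto
  next
    case False
    then have "fact 3 \<le> (fact m :: nat)" by (intro fact_mono) auto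
    with eq show ?thesis by (simp add: fact_numeral)
  qed
qed

definition factorial_prime_system :: "condition set" where
  "factorial_prime_system = {Fact_Eq 1 2, Succ_Eq 3 2, Succ_Eq 4 3, Fact_Eq 4 5, Not_Dvd 3 5}"

lemma factorial_prime_system_subset: "factorial_prime_system \<subseteq> conditions 5"
  by (auto simp: factorial_prime_system_def conditions_def)

text \<open>Restricted to \<open>{1..5}\<close> because solutions are extensional functions.
  Truncated subtraction is harmless when m! - 1 is prime, as then m! \<ge> 3.\<close>

definition factorial_prime_tuple :: "nat \<Rightarrow> nat \<Rightarrow> nat" where
  "factorial_prime_tuple m = (\<lambda>i\<in>{1..5}.
     if i = 1 then m else if i = 2 then fact m else if i = 3 then fact m - 1
     else if i = 4 then fact m - 2 else fact (fact m - 2))"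

lemma factorial_prime_tuple_5: "factorial_prime_tuple m 5 = fact (fact m - 2)"
  by (simp add: factorial_prime_tuple_def)

lemma solution_imp_tuple:
  assumes "x \<in> solutions 5 factorial_prime_system"
  shows "x = factorial_prime_tuple (x 1)" "1 \<le> x 1" "prime (fact (x 1) - 1 :: nat)"
proof -
  have ext: "x \<in> extensional {1..5}" and pos: "\<And>i. i \<in> {1..5} \<Longrightarrow> 1 \<le> x i"
    using assms by (auto simp: solutions_def PiE_def)
  have eqs: "fact (x 1) = x 2" "x 3 + 1 = x 2" "x 4 + 1 = x 3" "fact (x 4) = x 5"
    and not_dvd: "\<not> x 3 dvd x 5"
    using assms by (auto simp: solutions_def factorial_prime_system_def)
  have vals: "x 2 = fact (x 1)" "x 3 = fact (x 1) - 1" "x 4 = fact (x 1) - 2"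
    "x 5 = fact (fact (x 1) - 2)"
  proof -
    have "x 4 = x 2 - 2" using eqs(2,3) by simp
    then show "x 4 = fact (x 1) - 2" "x 5 = fact (fact (x 1) - 2)"
      using eqs(1,4) by simp_all
  qed (use eqs(1,2) in simp_all)
  show "x = factorial_prime_tuple (x 1)"
  proof
    fix i
    show "x i = factorial_prime_tuple (x 1) i"
    proof (cases "i \<in> {1..5}")
      case True
      then have "i = 1 \<or> i = 2 \<or> i = 3 \<or> i = 4 \<or> i = 5" by auto
      then show ?thesis
        using vals by (elim disjE) (simp_all add: factorial_prime_tuple_def)
    next
      case False
      then show ?thesis
        using ext by (auto simp: factorial_prime_tuple_def extensional_def)
    qed
  qed
  show "1 \<le> x 1" using pos by simp
  have "x 3 \<noteq> 4"
    using fact_neq_5[of "x 1"] eqs by auto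
  \<comment> \<open>This turns \<open>x 5\<close> into \<open>(x 3 - 1)!\<close>, the form the
    primality criterion expects.\<close>
  moreover have "x 4 = x 3 - 1" using eqs by simp
  ultimately have "prime (x 3)"
    using prime_if_not_dvd_fact_pred[of "x 3"] not_dvd eqs(3,4) by auto
  then show "prime (fact (x 1) - 1 :: nat)"
    using vals by simp
qed

lemma tuple_in_solutions:
  assumes "1 \<le> m" and p: "prime (fact m - 1 :: nat)"
  shows "factorial_prime_tuple m \<in> solutions 5 factorial_prime_system"
proof -
  \<comment> \<open>Makes both subtractions exact and the fourth entry m! - 2 positive.\<close>
  have ge: "3 \<le> (fact m :: nat)"
    using prime_ge_2_nat[OF p] by simp
  have "(fact m :: nat) - 1 - 1 = fact m - 2" by simp
  then have "\<not> (fact m - 1 :: nat) dvd fact (fact m - 2)"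
    using prime_not_dvd_fact_pred[OF p] by metis
  with ge \<open>1 \<le> m\<close> show ?thesis
    by (auto simp: solutions_def factorial_prime_system_def factorial_prime_tuple_def Suc_le_eq)
qed

lemma bound_f_5: "bound_f 5 = fact 720"
proof -
  have "bound_f 5 = fact (fact (fact 3))"
    by (simp only: numeral_eq_Suc pred_numeral_simps BitM.simps bound_f.simps)
  \<comment> \<open>Only the two inner factorials are evaluated; the outer one stays
    symbolic.\<close>
  also have "fact (fact 3) = (720 :: nat)"
    by (simp add: fact_numeral)
  finally show ?thesis .
qed

theorem theorem2:
  assumes "Phi 5"
  shows "infinite {m :: nat. m \<ge> 1 \<and> prime (fact m - 1 :: nat)}"
proof
  assume fin: "finite {m :: nat. m \<ge> 1 \<and> prime (fact m - 1 :: nat)}"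
  have "solutions 5 factorial_prime_system
      \<subseteq> factorial_prime_tuple ` {m. m \<ge> 1 \<and> prime (fact m - 1 :: nat)}"
    using solution_imp_tuple by blast
  then have "finite (solutions 5 factorial_prime_system)"
    using fin finite_surj by blast
  with assms factorial_prime_system_subset
  have bound: "x i \<le> bound_f 5" if "x \<in> solutions 5 factorial_prime_system" "i \<in> {1..5}" for x i
    using that unfolding Phi_def by blast
  have fact_7: "fact 7 = (5040 :: nat)"
    by (simp add: fact_numeral)
  \<comment> \<open>The witness \<open>m = 6\<close> would be too small: 6! - 1 = 719 is prime, but
    718! does not exceed 720!.\<close>
  have "(5039 :: nat) = fact 7 - 1"
    by (simp add: fact_7)
  with prime_5039 have "prime (fact 7 - 1 :: nat)"
    by (rule back_subst)
  then have "factorial_prime_tuple 7 \<in> solutions 5 factorial_prime_system"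
    by (rule tuple_in_solutions[rotated]) simp
  then have "factorial_prime_tuple 7 5 \<le> bound_f 5"
    by (rule bound) simp
  moreover have "factorial_prime_tuple 7 5 = fact (fact 7 - 2)"
    by (rule factorial_prime_tuple_5)
  ultimately have "fact (fact 7 - 2) \<le> (fact 720 :: nat)"
    by (simp only: bound_f_5)
  \<comment> \<open>By monotonicity it suffices to compare the arguments, 720 < 5038.\<close>
  moreover have "(fact 720 :: nat) < fact (fact 7 - 2)"
    by (rule fact_less_mono_nat) (simp_all add: fact_7)
  ultimately show False by (rule leD[THEN notE])
qed

end
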